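(* Let $G$ be a locally compact Hausdorff topological groupoid. Set $$T_G=\{\phi\in S_G: \{\phi(x)x : x\in G\}\ \text{is dense in } G\},$$ $$T'_G=\{\psi\in S'_G: \{x\psi(x): x\in G\}\ \text{is dense in } G\}.$$ Then $T_G$ is a left cancellative submonoid of $(S_G,\ast)$, $T'_G$ is a left cancellative submonoid of $(S'_G,\star)$, and $T_G$ is isomorphic to $T'_G$.
   Context: A groupoid $G$ has a partially defined product $(x,y)\mapsto xy$ on the set $G^2\subset G\times G$ of composable pairs, and an inverse map $x\mapsto x^{-1}$. Put $r(x)=xx^{-1}$ and $d(x)=x^{-1}x$; a pair $(x,y)$ is composable if and only if $d(x)=r(y)$. The unit space is $G^0=r(G)=d(G)$, and for $u\in G^0$, $G^u=r^{-1}(u)$ and $G_u=d^{-1}(u)$. A topological groupoid is a groupoid with a topology for which the inverse map and the product map $G^2\to G$ ($G^2$ with the topology induced from $G\times G$) are continuous; topologies are assumed locally compact and Hausdorff. $C(G,G)$ is the set of continuous maps from $G$ to $G$. Define $$S_G=\{f\in C(G,G): f(x)\in G_{r(x)}\text{ for all }x\in G\},\qquad S'_G=\{f\in C(G,G): f(x)\in G^{d(x)}\text{ for all }x\in G\}.$$ $S_G$ is a monoid with operation $(f\ast g)(x)=g(f(x)x)f(x)$ and identity $r$; $S'_G$ is a monoid with operation $(h\star k)(x)=h(x)k(xh(x))$ and identity $d$. A semigroup is left cancellative if $ab=ac$ implies $b=c$. *)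

theory Defs
  imports "HOL-Analysis.Analysis" "HOL-Algebra.Group"
begin

text \<open>The underlying set of the groupoid is \<open>topspace (topol G)\<close>; values of \<open>gmult\<close> outside
  \<open>composable G\<close> and of \<open>ginv\<close> outside the underlying set carry no meaning.\<close>

record 'a top_groupoid =
  topol :: "'a topology"
  composable :: "('a \<times> 'a) set"
  gmult :: "'a \<Rightarrow> 'a \<Rightarrow> 'a"
  ginv :: "'a \<Rightarrow> 'a"

abbreviation arrows :: "('a, 'm) top_groupoid_scheme \<Rightarrow> 'a set"
  where "arrows G \<equiv> topspace (topol G)"

definition range_map :: "('a, 'm) top_groupoid_scheme \<Rightarrow> 'a \<Rightarrow> 'a"
  where "range_map G x = gmult G x (ginv G x)"

definition domain_map :: "('a, 'm) top_groupoid_scheme \<Rightarrow> 'a \<Rightarrow> 'a"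
  where "domain_map G x = gmult G (ginv G x) x"

text \<open>Hahn's axioms. The description of composability through \<open>domain_map\<close> and \<open>range_map\<close> is a
  consequence, see \<open>composable_iff\<close> below.\<close>

locale topological_groupoid =
  fixes G :: "('a, 'm) top_groupoid_scheme"
  assumes composable_subset: "composable G \<subseteq> arrows G \<times> arrows G"
    and mult_closed: "(x, y) \<in> composable G \<Longrightarrow> gmult G x y \<in> arrows G"
    and inv_closed: "x \<in> arrows G \<Longrightarrow> ginv G x \<in> arrows G"
    and inv_inv: "x \<in> arrows G \<Longrightarrow> ginv G (ginv G x) = x"
    and assoc_composable_left:
      "\<lbrakk>(x, y) \<in> composable G; (y, z) \<in> composable G\<rbrakk> \<Longrightarrow> (gmult G x y, z) \<in> composable G"
    and assoc_composable_right:
      "\<lbrakk>(x, y) \<in> composable G; (y, z) \<in> composable G\<rbrakk> \<Longrightarrow> (x, gmult G y z) \<in> composable G"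
    and assoc:
      "\<lbrakk>(x, y) \<in> composable G; (y, z) \<in> composable G\<rbrakk>
        \<Longrightarrow> gmult G (gmult G x y) z = gmult G x (gmult G y z)"
    and inv_composable_left: "x \<in> arrows G \<Longrightarrow> (ginv G x, x) \<in> composable G"
    and inv_composable_right: "x \<in> arrows G \<Longrightarrow> (x, ginv G x) \<in> composable G"
    and cancel_left: "(x, y) \<in> composable G \<Longrightarrow> gmult G (ginv G x) (gmult G x y) = y"
    and cancel_right: "(z, x) \<in> composable G \<Longrightarrow> gmult G (gmult G z x) (ginv G x) = z"
    and continuous_inv: "continuous_map (topol G) (topol G) (ginv G)"
    and continuous_mult:
      "continuous_map (subtopology (prod_topology (topol G) (topol G)) (composable G)) (topol G)
        (\<lambda>(x, y). gmult G x y)"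

definition range_fibre :: "('a, 'm) top_groupoid_scheme \<Rightarrow> 'a \<Rightarrow> 'a set"
  where "range_fibre G u = {x \<in> arrows G. range_map G x = u}"

definition domain_fibre :: "('a, 'm) top_groupoid_scheme \<Rightarrow> 'a \<Rightarrow> 'a set"
  where "domain_fibre G u = {x \<in> arrows G. domain_map G x = u}"

text \<open>Maps from \<open>G\<close> to \<open>G\<close> are represented by functions that are \<open>undefined\<close> outside the underlying
  set, so that equality of such functions is equality of maps on \<open>G\<close>.\<close>

definition continuous_self_maps :: "('a, 'm) top_groupoid_scheme \<Rightarrow> ('a \<Rightarrow> 'a) set"
  where "continuous_self_maps G =
    {f \<in> extensional (arrows G). continuous_map (topol G) (topol G) f}"

definition S_monoid :: "('a, 'm) top_groupoid_scheme \<Rightarrow> ('a \<Rightarrow> 'a) monoid"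
  where "S_monoid G =
    \<lparr>carrier = {f \<in> continuous_self_maps G. \<forall>x\<in>arrows G. f x \<in> domain_fibre G (range_map G x)},
     mult = (\<lambda>f g. \<lambda>x\<in>arrows G. gmult G (g (gmult G (f x) x)) (f x)),
     one = (\<lambda>x\<in>arrows G. range_map G x)\<rparr>"

definition S'_monoid :: "('a, 'm) top_groupoid_scheme \<Rightarrow> ('a \<Rightarrow> 'a) monoid"
  where "S'_monoid G =
    \<lparr>carrier = {f \<in> continuous_self_maps G. \<forall>x\<in>arrows G. f x \<in> range_fibre G (domain_map G x)},
     mult = (\<lambda>h k. \<lambda>x\<in>arrows G. gmult G (h x) (k (gmult G x (h x)))),
     one = (\<lambda>x\<in>arrows G. domain_map G x)\<rparr>"

definition dense_set :: "'a topology \<Rightarrow> 'a set \<Rightarrow> bool"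
  where "dense_set X A \<longleftrightarrow> A \<subseteq> topspace X \<and> X closure_of A = topspace X"

definition T_set :: "('a, 'm) top_groupoid_scheme \<Rightarrow> ('a \<Rightarrow> 'a) set"
  where "T_set G =
    {\<phi> \<in> carrier (S_monoid G). dense_set (topol G) {gmult G (\<phi> x) x | x. x \<in> arrows G}}"

definition T'_set :: "('a, 'm) top_groupoid_scheme \<Rightarrow> ('a \<Rightarrow> 'a) set"
  where "T'_set G =
    {\<psi> \<in> carrier (S'_monoid G). dense_set (topol G) {gmult G x (\<psi> x) | x. x \<in> arrows G}}"

definition left_cancellative :: "('b, 'm) monoid_scheme \<Rightarrow> bool"
  where "left_cancellative M \<longleftrightarrow>
    (\<forall>a\<in>carrier M. \<forall>b\<in>carrier M. \<forall>c\<in>carrier M.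
      a \<otimes>\<^bsub>M\<^esub> b = a \<otimes>\<^bsub>M\<^esub> c \<longrightarrow> b = c)"

context topological_groupoid
begin

lemma composable_iff:
  "(x, y) \<in> composable G \<longleftrightarrow> x \<in> arrows G \<and> y \<in> arrows G \<and> domain_map G x = range_map G y"
proof
  assume xy: "(x, y) \<in> composable G"
  then have x: "x \<in> arrows G" and y: "y \<in> arrows G"
    using composable_subset by auto
  have c: "(domain_map G x, y) \<in> composable G"
    unfolding domain_map_def by (rule assoc_composable_left[OF inv_composable_left[OF x] xy])
  have "gmult G (domain_map G x) y = y"
    unfolding domain_map_def
    using assoc[OF inv_composable_left[OF x] xy] cancel_left[OF xy] by simp
  then have "domain_map G x = range_map G y"
    using cancel_right[OF c] by (simp add: range_map_def)
  with x y show "x \<in> arrows G \<and> y \<in> arrows G \<and> domain_map G x = range_map G y"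
    by simp
next
  assume A: "x \<in> arrows G \<and> y \<in> arrows G \<and> domain_map G x = range_map G y"
  then have x: "x \<in> arrows G" and y: "y \<in> arrows G" and e: "domain_map G x = range_map G y"
    by auto
  have 1: "(x, domain_map G x) \<in> composable G"
    unfolding domain_map_def
    by (rule assoc_composable_right[OF inv_composable_right[OF x] inv_composable_left[OF x]])
  have 2: "(range_map G y, y) \<in> composable G"
    unfolding range_map_def
    by (rule assoc_composable_left[OF inv_composable_right[OF y] inv_composable_left[OF y]])
  have "gmult G x (domain_map G x) = x"
    unfolding domain_map_def
    using cancel_left[OF inv_composable_left[OF x]] inv_inv[OF x] by simp
  then show "(x, y) \<in> composable G"
    using assoc_composable_left[OF 1 2[folded e]] by simp
qed

lemma mult_facts:
  assumes "(x, y) \<in> composable G"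
  shows "range_map G (gmult G x y) = range_map G x"
    and "domain_map G (gmult G x y) = domain_map G y"
proof -
  have x: "x \<in> arrows G" and y: "y \<in> arrows G"
    using assms composable_subset by auto
  have ix: "ginv G x \<in> arrows G" and iy: "ginv G y \<in> arrows G"
    using inv_closed x y by auto
  have rx: "domain_map G (ginv G x) = range_map G x"
    by (simp add: domain_map_def range_map_def inv_inv x)
  have dy: "range_map G (ginv G y) = domain_map G y"
    by (simp add: domain_map_def range_map_def inv_inv y)
  have "(ginv G x, gmult G x y) \<in> composable G"
    by (rule assoc_composable_right[OF inv_composable_left[OF x] assms])
  then show "range_map G (gmult G x y) = range_map G x"
    using rx by (simp add: composable_iff)
  have "(gmult G x y, ginv G y) \<in> composable G"
    by (rule assoc_composable_left[OF assms inv_composable_right[OF y]])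
  then show "domain_map G (gmult G x y) = domain_map G y"
    using dy by (simp add: composable_iff)
qed

lemma unit_facts:
  assumes x: "x \<in> arrows G"
  shows "range_map G x \<in> arrows G" "domain_map G x \<in> arrows G"
    and "range_map G (range_map G x) = range_map G x"
    and "domain_map G (range_map G x) = range_map G x"
    and "range_map G (domain_map G x) = domain_map G x"
    and "domain_map G (domain_map G x) = domain_map G x"
    and "gmult G (range_map G x) x = x" "gmult G x (domain_map G x) = x"
proof -
  have ix: "ginv G x \<in> arrows G"
    using inv_closed x by auto
  note l = inv_composable_left[OF x] and r = inv_composable_right[OF x]
  show "range_map G x \<in> arrows G" "domain_map G x \<in> arrows G"
    unfolding range_map_def domain_map_def using l r mult_closed by auto
  show 1: "range_map G (range_map G x) = range_map G x"
    using mult_facts(1)[OF r] by (simp add: range_map_def)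
  show "domain_map G (range_map G x) = range_map G x"
    using mult_facts(2)[OF r] inv_inv[OF x] by (simp add: range_map_def domain_map_def)
  show "range_map G (domain_map G x) = domain_map G x"
    using mult_facts(1)[OF l] inv_inv[OF x] by (simp add: range_map_def domain_map_def)
  show "domain_map G (domain_map G x) = domain_map G x"
    using mult_facts(2)[OF l] by (simp add: domain_map_def)
  show "gmult G (range_map G x) x = x"
    using cancel_right[OF r] inv_inv[OF x] by (simp add: range_map_def)
  show "gmult G x (domain_map G x) = x"
    using cancel_left[OF l] inv_inv[OF x] by (simp add: domain_map_def)
qed

lemma continuous_mult_comp:
  assumes "continuous_map X (topol G) f" "continuous_map X (topol G) g"
    and "\<And>x. x \<in> topspace X \<Longrightarrow> (f x, g x) \<in> composable G"
  shows "continuous_map X (topol G) (\<lambda>x. gmult G (f x) (g x))"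
proof -
  have "continuous_map X (subtopology (prod_topology (topol G) (topol G)) (composable G))
      (\<lambda>x. (f x, g x))"
    using assms by (auto simp: continuous_map_in_subtopology continuous_map_paired)
  from continuous_map_compose[OF this continuous_mult] show ?thesis
    by (simp add: o_def)
qed

lemma continuous_range_map: "continuous_map (topol G) (topol G) (range_map G)"
  unfolding range_map_def[abs_def]
  by (rule continuous_mult_comp)
    (use continuous_inv inv_composable_right in \<open>auto simp: continuous_map_id[unfolded id_def]\<close>)

lemma continuous_domain_map: "continuous_map (topol G) (topol G) (domain_map G)"
  unfolding domain_map_def[abs_def]
  by (rule continuous_mult_comp)
    (use continuous_inv inv_composable_left in \<open>auto simp: continuous_map_id[unfolded id_def]\<close>)

lemma S_carrier_iff:
  "f \<in> carrier (S_monoid G) \<longleftrightarrow>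
    f \<in> extensional (arrows G) \<and> continuous_map (topol G) (topol G) f \<and>
    (\<forall>x\<in>arrows G. f x \<in> arrows G \<and> domain_map G (f x) = range_map G x)"
  by (auto simp: S_monoid_def continuous_self_maps_def domain_fibre_def)

lemma S'_carrier_iff:
  "f \<in> carrier (S'_monoid G) \<longleftrightarrow>
    f \<in> extensional (arrows G) \<and> continuous_map (topol G) (topol G) f \<and>
    (\<forall>x\<in>arrows G. f x \<in> arrows G \<and> range_map G (f x) = domain_map G x)"
  by (auto simp: S'_monoid_def continuous_self_maps_def range_fibre_def)

lemma continuous_map_restrict:
  "continuous_map (topol G) (topol G) (restrict f (arrows G)) \<longleftrightarrow>
    continuous_map (topol G) (topol G) f"
  by (rule iffI; erule continuous_map_eq) auto

lemma S_translation:
  assumes "f \<in> carrier (S_monoid G)"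
  shows "x \<in> arrows G \<Longrightarrow> (f x, x) \<in> composable G"
    and "continuous_map (topol G) (topol G) (\<lambda>x. gmult G (f x) x)"
proof -
  show c: "(f x, x) \<in> composable G" if "x \<in> arrows G" for x
    using assms that by (simp add: S_carrier_iff composable_iff)
  show "continuous_map (topol G) (topol G) (\<lambda>x. gmult G (f x) x)"
    by (rule continuous_mult_comp)
      (use assms c in \<open>auto simp: S_carrier_iff continuous_map_id[unfolded id_def]\<close>)
qed

lemma S'_translation:
  assumes "f \<in> carrier (S'_monoid G)"
  shows "x \<in> arrows G \<Longrightarrow> (x, f x) \<in> composable G"
    and "continuous_map (topol G) (topol G) (\<lambda>x. gmult G x (f x))"
proof -
  show c: "(x, f x) \<in> composable G" if "x \<in> arrows G" for x
    using assms that by (simp add: S'_carrier_iff composable_iff)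
  show "continuous_map (topol G) (topol G) (\<lambda>x. gmult G x (f x))"
    by (rule continuous_mult_comp)
      (use assms c in \<open>auto simp: S'_carrier_iff continuous_map_id[unfolded id_def]\<close>)
qed

lemma S_mult_composable:
  assumes "f \<in> carrier (S_monoid G)" "g \<in> carrier (S_monoid G)" "x \<in> arrows G"
  shows "(g (gmult G (f x) x), f x) \<in> composable G"
  using assms S_translation(1)[OF assms(1,3)] mult_closed[of "f x" x]
  by (auto simp: composable_iff[of _ "f x"] S_carrier_iff mult_facts)

lemma S'_mult_composable:
  assumes "h \<in> carrier (S'_monoid G)" "k \<in> carrier (S'_monoid G)" "x \<in> arrows G"
  shows "(h x, k (gmult G x (h x))) \<in> composable G"
  using assms S'_translation(1)[OF assms(1,3)] mult_closed[of x "h x"]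
  by (auto simp: composable_iff[of "h x"] S'_carrier_iff mult_facts)

lemma S_mult_apply:
  "x \<in> arrows G \<Longrightarrow> (f \<otimes>\<^bsub>S_monoid G\<^esub> g) x = gmult G (g (gmult G (f x) x)) (f x)"
  by (simp add: S_monoid_def)

lemma S'_mult_apply:
  "x \<in> arrows G \<Longrightarrow> (h \<otimes>\<^bsub>S'_monoid G\<^esub> k) x = gmult G (h x) (k (gmult G x (h x)))"
  by (simp add: S'_monoid_def)

lemma S_mult_closed:
  assumes f: "f \<in> carrier (S_monoid G)" and g: "g \<in> carrier (S_monoid G)"
  shows "f \<otimes>\<^bsub>S_monoid G\<^esub> g \<in> carrier (S_monoid G)"
proof -
  have "continuous_map (topol G) (topol G) (\<lambda>x. gmult G (g (gmult G (f x) x)) (f x))"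
  proof (rule continuous_mult_comp)
    show "continuous_map (topol G) (topol G) (\<lambda>x. g (gmult G (f x) x))"
      using continuous_map_compose[OF S_translation(2)[OF f], of "topol G" g] g
      by (simp add: S_carrier_iff o_def)
  qed (use f S_mult_composable[OF f g] in \<open>auto simp: S_carrier_iff\<close>)
  then have "continuous_map (topol G) (topol G) (f \<otimes>\<^bsub>S_monoid G\<^esub> g)"
    by (simp add: S_monoid_def continuous_map_restrict)
  moreover have "f \<otimes>\<^bsub>S_monoid G\<^esub> g \<in> extensional (arrows G)"
    by (simp add: S_monoid_def)
  ultimately show ?thesis
    using S_mult_composable[OF f g] f
    by (auto simp: S_carrier_iff S_mult_apply mult_facts mult_closed)
qed

lemma S'_mult_closed:
  assumes h: "h \<in> carrier (S'_monoid G)" and k: "k \<in> carrier (S'_monoid G)"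
  shows "h \<otimes>\<^bsub>S'_monoid G\<^esub> k \<in> carrier (S'_monoid G)"
proof -
  have "continuous_map (topol G) (topol G) (\<lambda>x. gmult G (h x) (k (gmult G x (h x))))"
  proof (rule continuous_mult_comp)
    show "continuous_map (topol G) (topol G) (\<lambda>x. k (gmult G x (h x)))"
      using continuous_map_compose[OF S'_translation(2)[OF h], of "topol G" k] k
      by (simp add: S'_carrier_iff o_def)
  qed (use h S'_mult_composable[OF h k] in \<open>auto simp: S'_carrier_iff\<close>)
  then have "continuous_map (topol G) (topol G) (h \<otimes>\<^bsub>S'_monoid G\<^esub> k)"
    by (simp add: S'_monoid_def continuous_map_restrict)
  moreover have "h \<otimes>\<^bsub>S'_monoid G\<^esub> k \<in> extensional (arrows G)"
    by (simp add: S'_monoid_def)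
  ultimately show ?thesis
    using S'_mult_composable[OF h k] h
    by (auto simp: S'_carrier_iff S'_mult_apply mult_facts mult_closed)
qed

lemma S_one_closed: "\<one>\<^bsub>S_monoid G\<^esub> \<in> carrier (S_monoid G)"
proof -
  have "continuous_map (topol G) (topol G) (\<one>\<^bsub>S_monoid G\<^esub>)"
    using continuous_range_map by (simp add: S_monoid_def continuous_map_restrict)
  then show ?thesis
    by (simp add: S_carrier_iff) (simp add: S_monoid_def unit_facts)
qed

lemma S'_one_closed: "\<one>\<^bsub>S'_monoid G\<^esub> \<in> carrier (S'_monoid G)"
proof -
  have "continuous_map (topol G) (topol G) (\<one>\<^bsub>S'_monoid G\<^esub>)"
    using continuous_domain_map by (simp add: S'_monoid_def continuous_map_restrict)
  then show ?thesis
    by (simp add: S'_carrier_iff) (simp add: S'_monoid_def unit_facts)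
qed

lemma S_translation_mult:
  assumes "f \<in> carrier (S_monoid G)" "g \<in> carrier (S_monoid G)" "x \<in> arrows G"
  shows "gmult G ((f \<otimes>\<^bsub>S_monoid G\<^esub> g) x) x = gmult G (g (gmult G (f x) x)) (gmult G (f x) x)"
  using assms assoc[OF S_mult_composable[OF assms] S_translation(1)[OF assms(1,3)]]
  by (simp add: S_mult_apply)

lemma S'_translation_mult:
  assumes "h \<in> carrier (S'_monoid G)" "k \<in> carrier (S'_monoid G)" "x \<in> arrows G"
  shows "gmult G x ((h \<otimes>\<^bsub>S'_monoid G\<^esub> k) x) = gmult G (gmult G x (h x)) (k (gmult G x (h x)))"
  using assms assoc[OF S'_translation(1)[OF assms(1,3)] S'_mult_composable[OF assms]]
  by (simp add: S'_mult_apply)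

lemma S_is_monoid: "monoid (S_monoid G)"
proof (rule monoidI)
  fix f g k
  assume f: "f \<in> carrier (S_monoid G)" and g: "g \<in> carrier (S_monoid G)"
    and k: "k \<in> carrier (S_monoid G)"
  show "f \<otimes>\<^bsub>S_monoid G\<^esub> g \<otimes>\<^bsub>S_monoid G\<^esub> k = f \<otimes>\<^bsub>S_monoid G\<^esub> (g \<otimes>\<^bsub>S_monoid G\<^esub> k)"
  proof (rule extensionalityI[of _ "arrows G"])
    fix x assume x: "x \<in> arrows G"
    define y where "y = gmult G (f x) x"
    have y: "y \<in> arrows G"
      unfolding y_def using S_translation(1)[OF f x] by (rule mult_closed)
    have 1: "(f \<otimes>\<^bsub>S_monoid G\<^esub> g \<otimes>\<^bsub>S_monoid G\<^esub> k) x =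
        gmult G (k (gmult G (g y) y)) ((f \<otimes>\<^bsub>S_monoid G\<^esub> g) x)"
      by (simp only: S_mult_apply[OF x, of "f \<otimes>\<^bsub>S_monoid G\<^esub> g" k] S_translation_mult[OF f g x, folded y_def])
    show "(f \<otimes>\<^bsub>S_monoid G\<^esub> g \<otimes>\<^bsub>S_monoid G\<^esub> k) x =
        (f \<otimes>\<^bsub>S_monoid G\<^esub> (g \<otimes>\<^bsub>S_monoid G\<^esub> k)) x"
      using assoc[OF S_mult_composable[OF g k y] S_mult_composable[OF f g x, folded y_def]]
      unfolding 1 by (simp add: S_mult_apply[OF x] S_mult_apply[OF y] flip: y_def)
  qed (simp_all add: S_monoid_def)
next
  fix f assume f: "f \<in> carrier (S_monoid G)"
  show "\<one>\<^bsub>S_monoid G\<^esub> \<otimes>\<^bsub>S_monoid G\<^esub> f = f"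
  proof (rule extensionalityI[of _ "arrows G"])
    fix x assume x: "x \<in> arrows G"
    have "gmult G (f x) (domain_map G (f x)) = f x"
      using f x unit_facts(8)[of "f x"] by (auto simp: S_carrier_iff)
    then show "(\<one>\<^bsub>S_monoid G\<^esub> \<otimes>\<^bsub>S_monoid G\<^esub> f) x = f x"
      using f x by (simp add: S_carrier_iff S_mult_apply) (simp add: S_monoid_def unit_facts)
  qed (use f in \<open>simp_all add: S_carrier_iff\<close>, simp add: S_monoid_def)
  show "f \<otimes>\<^bsub>S_monoid G\<^esub> \<one>\<^bsub>S_monoid G\<^esub> = f"
  proof (rule extensionalityI[of _ "arrows G"])
    fix x assume x: "x \<in> arrows G"
    have "gmult G (f x) x \<in> arrows G"
      using S_translation(1)[OF f x] by (rule mult_closed)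
    then show "(f \<otimes>\<^bsub>S_monoid G\<^esub> \<one>\<^bsub>S_monoid G\<^esub>) x = f x"
      using f x S_translation(1)[OF f x]
      by (simp add: S_carrier_iff S_mult_apply) (simp add: S_monoid_def unit_facts mult_facts)
  qed (use f in \<open>simp_all add: S_carrier_iff\<close>, simp add: S_monoid_def)
qed (auto intro: S_mult_closed S_one_closed)

lemma S'_is_monoid: "monoid (S'_monoid G)"
proof (rule monoidI)
  fix f g k
  assume f: "f \<in> carrier (S'_monoid G)" and g: "g \<in> carrier (S'_monoid G)"
    and k: "k \<in> carrier (S'_monoid G)"
  show "f \<otimes>\<^bsub>S'_monoid G\<^esub> g \<otimes>\<^bsub>S'_monoid G\<^esub> k = f \<otimes>\<^bsub>S'_monoid G\<^esub> (g \<otimes>\<^bsub>S'_monoid G\<^esub> k)"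
  proof (rule extensionalityI[of _ "arrows G"])
    fix x assume x: "x \<in> arrows G"
    define y where "y = gmult G x (f x)"
    have y: "y \<in> arrows G"
      unfolding y_def using S'_translation(1)[OF f x] by (rule mult_closed)
    have 1: "(f \<otimes>\<^bsub>S'_monoid G\<^esub> g \<otimes>\<^bsub>S'_monoid G\<^esub> k) x =
        gmult G ((f \<otimes>\<^bsub>S'_monoid G\<^esub> g) x) (k (gmult G y (g y)))"
      by (simp only: S'_mult_apply[OF x, of "f \<otimes>\<^bsub>S'_monoid G\<^esub> g" k] S'_translation_mult[OF f g x, folded y_def])
    show "(f \<otimes>\<^bsub>S'_monoid G\<^esub> g \<otimes>\<^bsub>S'_monoid G\<^esub> k) x =
        (f \<otimes>\<^bsub>S'_monoid G\<^esub> (g \<otimes>\<^bsub>S'_monoid G\<^esub> k)) x"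
      using assoc[OF S'_mult_composable[OF f g x, folded y_def] S'_mult_composable[OF g k y]]
      unfolding 1 by (simp add: S'_mult_apply[OF x] S'_mult_apply[OF y] flip: y_def)
  qed (simp_all add: S'_monoid_def)
next
  fix f assume f: "f \<in> carrier (S'_monoid G)"
  show "\<one>\<^bsub>S'_monoid G\<^esub> \<otimes>\<^bsub>S'_monoid G\<^esub> f = f"
  proof (rule extensionalityI[of _ "arrows G"])
    fix x assume x: "x \<in> arrows G"
    have "gmult G (range_map G (f x)) (f x) = f x"
      using f x unit_facts(7)[of "f x"] by (auto simp: S'_carrier_iff)
    then show "(\<one>\<^bsub>S'_monoid G\<^esub> \<otimes>\<^bsub>S'_monoid G\<^esub> f) x = f x"
      using f x by (simp add: S'_carrier_iff S'_mult_apply) (simp add: S'_monoid_def unit_facts)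
  qed (use f in \<open>simp_all add: S'_carrier_iff\<close>, simp add: S'_monoid_def)
  show "f \<otimes>\<^bsub>S'_monoid G\<^esub> \<one>\<^bsub>S'_monoid G\<^esub> = f"
  proof (rule extensionalityI[of _ "arrows G"])
    fix x assume x: "x \<in> arrows G"
    have "gmult G x (f x) \<in> arrows G"
      using S'_translation(1)[OF f x] by (rule mult_closed)
    then show "(f \<otimes>\<^bsub>S'_monoid G\<^esub> \<one>\<^bsub>S'_monoid G\<^esub>) x = f x"
      using f x S'_translation(1)[OF f x]
      by (simp add: S'_carrier_iff S'_mult_apply) (simp add: S'_monoid_def unit_facts mult_facts)
  qed (use f in \<open>simp_all add: S'_carrier_iff\<close>, simp add: S'_monoid_def)
qed (auto intro: S'_mult_closed S'_one_closed)

end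

abbreviation T_monoid :: "('a, 'm) top_groupoid_scheme \<Rightarrow> ('a \<Rightarrow> 'a) monoid"
  where "T_monoid G \<equiv> (S_monoid G)\<lparr>carrier := T_set G\<rparr>"

abbreviation T'_monoid :: "('a, 'm) top_groupoid_scheme \<Rightarrow> ('a \<Rightarrow> 'a) monoid"
  where "T'_monoid G \<equiv> (S'_monoid G)\<lparr>carrier := T'_set G\<rparr>"

end

theory Submission
  imports Defs
begin

text \<open>
  An element \<open>\<phi>\<close> of \<open>S\<^sub>G\<close> is encoded by its translation \<open>L\<^sub>\<phi> x = \<phi>(x) x\<close>, a continuous self-map of
  \<open>G\<close>, and \<open>\<phi> \<mapsto> L\<^sub>\<phi>\<close> reverses products: \<open>L\<^bsub>\<phi> \<ast> \<psi>\<^esub> = L\<^sub>\<psi> \<circ> L\<^sub>\<phi>\<close> (\<open>S_translation_mult\<close>). So \<open>T\<^sub>G\<close> consists of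
  the \<open>\<phi>\<close> whose translation has dense range. Continuous self-maps with dense range are closed under
  composition, and the identity \<open>r\<close> of \<open>S\<^sub>G\<close> has translation the identity map; hence \<open>T\<^sub>G\<close> is a submonoid.

  If \<open>\<phi> \<ast> \<alpha> = \<phi> \<ast> \<beta>\<close>, then \<open>\<alpha>(L\<^sub>\<phi> x) \<phi>(x) = \<beta>(L\<^sub>\<phi> x) \<phi>(x)\<close>, and right cancellation in the groupoid
  shows that \<open>\<alpha>\<close> and \<open>\<beta>\<close> agree on the range of \<open>L\<^sub>\<phi>\<close>. When this range is dense, the continuous maps
  \<open>\<alpha>\<close> and \<open>\<beta>\<close> into the Hausdorff space \<open>G\<close> are equal.

  Inversion is an anti-automorphism of \<open>G\<close>, so conjugation by it, \<open>\<phi>\<^sup>*(x) = \<phi>(x\<inverse>)\<inverse>\<close>, exchanges left and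
  right translations: \<open>x \<phi>\<^sup>*(x) = (\<phi>(x\<inverse>) x\<inverse>)\<inverse>\<close>. It is an isomorphism of \<open>S\<^sub>G\<close> onto \<open>S'\<^sub>G\<close>
  (\<open>conj_inv_mult\<close>), and since inversion is a homeomorphism it preserves dense ranges, so it carries
  \<open>T\<^sub>G\<close> onto \<open>T'\<^sub>G\<close>. The statements about \<open>T'\<^sub>G\<close> are then transported along this isomorphism.
\<close>

text \<open>Both the composition of maps with dense range and the image of a dense set under a
  homeomorphism are instances of this lemma.\<close>

lemma dense_set_image:
  assumes f: "continuous_map X Y f" and A: "dense_set X A"
    and range: "dense_set Y (f ` topspace X)"
  shows "dense_set Y (f ` A)"
proof -
  have "f ` topspace X \<subseteq> Y closure_of (f ` A)"
    using continuous_map_image_closure_subset[OF f, of A] A by (simp add: dense_set_def)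
  then have "Y closure_of (f ` topspace X) \<subseteq> Y closure_of (f ` A)"
    by (simp add: closure_of_minimal)
  moreover have "f ` A \<subseteq> topspace Y"
    using A continuous_map_image_subset_topspace[OF f] by (auto simp: dense_set_def)
  ultimately show ?thesis
    using range closure_of_subset_topspace[of Y "f ` A"] by (auto simp: dense_set_def)
qed

lemma left_cancellative_iso:
  assumes \<theta>: "\<theta> \<in> iso M N" and M: "left_cancellative M"
    and closed: "\<And>a b. \<lbrakk>a \<in> carrier M; b \<in> carrier M\<rbrakk> \<Longrightarrow> a \<otimes>\<^bsub>M\<^esub> b \<in> carrier M"
  shows "left_cancellative N"
proof -
  have mult: "\<theta> (a \<otimes>\<^bsub>M\<^esub> b) = \<theta> a \<otimes>\<^bsub>N\<^esub> \<theta> b" if "a \<in> carrier M" "b \<in> carrier M" for a b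
    using \<theta> that by (auto simp: iso_def hom_def)
  have inj: "inj_on \<theta> (carrier M)" and im: "carrier N = \<theta> ` carrier M"
    using \<theta> by (auto simp: iso_def bij_betw_def)
  show ?thesis
    unfolding left_cancellative_def im
  proof (clarsimp)
    fix a b c
    assume abc: "a \<in> carrier M" "b \<in> carrier M" "c \<in> carrier M"
      and "\<theta> a \<otimes>\<^bsub>N\<^esub> \<theta> b = \<theta> a \<otimes>\<^bsub>N\<^esub> \<theta> c"
    then have "a \<otimes>\<^bsub>M\<^esub> b = a \<otimes>\<^bsub>M\<^esub> c"
      using inj closed by (metis mult inj_onD)
    then show "\<theta> b = \<theta> c"
      using M abc unfolding left_cancellative_def by blast
  qed
qed

definition conj_inv :: "('a, 'm) top_groupoid_scheme \<Rightarrow> ('a \<Rightarrow> 'a) \<Rightarrow> 'a \<Rightarrow> 'a"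
  where "conj_inv G f = (\<lambda>x\<in>arrows G. ginv G (f (ginv G x)))"

context topological_groupoid
begin

lemma inv_mult:
  assumes xy: "(x, y) \<in> composable G"
  shows "ginv G (gmult G x y) = gmult G (ginv G y) (ginv G x)"
proof -
  let ?p = "gmult G x y"
  have y: "y \<in> arrows G"
    using xy composable_subset by auto
  have p: "?p \<in> arrows G"
    using xy by (rule mult_closed)
  have p_y: "(?p, ginv G y) \<in> composable G"
    by (rule assoc_composable_left[OF xy inv_composable_right[OF y]])
  have px: "gmult G (ginv G ?p) x = ginv G y"
    using cancel_left[OF p_y] cancel_right[OF xy] by simp
  have "(ginv G ?p, x) \<in> composable G"
    using assoc_composable_right[OF inv_composable_left[OF p] p_y] cancel_right[OF xy] by simp
  from cancel_right[OF this] show ?thesis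
    by (simp add: px)
qed

lemma range_map_inv: "x \<in> arrows G \<Longrightarrow> range_map G (ginv G x) = domain_map G x"
  by (simp add: range_map_def domain_map_def inv_inv)

lemma domain_map_inv: "x \<in> arrows G \<Longrightarrow> domain_map G (ginv G x) = range_map G x"
  by (simp add: range_map_def domain_map_def inv_inv)

lemma inv_domain_map: "x \<in> arrows G \<Longrightarrow> ginv G (domain_map G x) = domain_map G x"
  using inv_mult[OF inv_composable_left] by (simp add: domain_map_def inv_inv)

lemma inv_image_arrows: "ginv G ` arrows G = arrows G"
  by (rule bij_betw_imp_surj_on, rule bij_betw_byWitness[where f' = "ginv G"])
    (auto simp: inv_closed inv_inv)

lemma dense_set_inv_image:
  assumes "dense_set (topol G) A"
  shows "dense_set (topol G) (ginv G ` A)"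
  using continuous_inv assms
  by (rule dense_set_image) (simp add: inv_image_arrows dense_set_def)

lemma T_set_iff:
  "f \<in> T_set G \<longleftrightarrow> f \<in> carrier (S_monoid G) \<and>
    dense_set (topol G) ((\<lambda>x. gmult G (f x) x) ` arrows G)"
  by (simp add: T_set_def Setcompr_eq_image)

lemma T'_set_iff:
  "f \<in> T'_set G \<longleftrightarrow> f \<in> carrier (S'_monoid G) \<and>
    dense_set (topol G) ((\<lambda>x. gmult G x (f x)) ` arrows G)"
  by (simp add: T'_set_def Setcompr_eq_image)

lemma T_one_closed: "\<one>\<^bsub>S_monoid G\<^esub> \<in> T_set G"
proof -
  have "(\<lambda>x. gmult G (\<one>\<^bsub>S_monoid G\<^esub> x) x) ` arrows G = arrows G"
    by (simp add: S_monoid_def unit_facts cong: image_cong)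
  then show ?thesis
    by (simp add: T_set_iff S_one_closed dense_set_def)
qed

lemma T_mult_closed:
  assumes f: "f \<in> T_set G" and g: "g \<in> T_set G"
  shows "f \<otimes>\<^bsub>S_monoid G\<^esub> g \<in> T_set G"
proof -
  have S: "f \<in> carrier (S_monoid G)" "g \<in> carrier (S_monoid G)"
    using f g by (auto simp: T_set_iff)
  have "(\<lambda>x. gmult G ((f \<otimes>\<^bsub>S_monoid G\<^esub> g) x) x) ` arrows G =
      (\<lambda>y. gmult G (g y) y) ` (\<lambda>x. gmult G (f x) x) ` arrows G"
    by (simp add: image_image S_translation_mult[OF S] cong: image_cong)
  moreover have "dense_set (topol G) \<dots>"
    by (rule dense_set_image[OF S_translation(2)[OF S(2)]])
      (use f g in \<open>simp_all add: T_set_iff\<close>)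
  ultimately show ?thesis
    using S_mult_closed[OF S] by (simp add: T_set_iff)
qed

lemma T_submonoid: "submonoid (T_set G) (S_monoid G)"
  by standard (auto simp: T_one_closed T_mult_closed, simp add: T_set_iff)

text \<open>The products with \<open>a\<close> determine the right factor on the range of the translation of \<open>a\<close>;
  density, continuity and the Hausdorff property extend the agreement to all of \<open>G\<close>.\<close>

lemma S_mult_left_cancel:
  assumes H: "Hausdorff_space (topol G)" and a: "a \<in> T_set G"
    and b: "b \<in> carrier (S_monoid G)" and c: "c \<in> carrier (S_monoid G)"
    and eq: "a \<otimes>\<^bsub>S_monoid G\<^esub> b = a \<otimes>\<^bsub>S_monoid G\<^esub> c"
  shows "b = c"
proof -
  let ?L = "\<lambda>x. gmult G (a x) x"
  have aS: "a \<in> carrier (S_monoid G)"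
    using a by (simp add: T_set_iff)
  have on_range: "b y = c y" if y_range: "y \<in> ?L ` arrows G" for y
  proof -
    obtain x where x: "x \<in> arrows G" and y: "y = ?L x"
      using y_range by blast
    have "gmult G (b y) (a x) = gmult G (c y) (a x)"
      using fun_cong[OF eq, of x] by (simp add: S_mult_apply x y)
    then show ?thesis
      using cancel_right[OF S_mult_composable[OF aS b x]]
        cancel_right[OF S_mult_composable[OF aS c x]] y by metis
  qed
  show ?thesis
  proof (rule extensionalityI[of _ "arrows G"])
    fix x assume "x \<in> arrows G"
    then have "x \<in> topol G closure_of (?L ` arrows G)"
      using a by (simp add: T_set_iff dense_set_def)
    then show "b x = c x"
      by (rule forall_in_closure_of_eq[OF _ H])
        (use b c on_range in \<open>simp_all add: S_carrier_iff\<close>)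
  qed (use b c in \<open>auto simp: S_carrier_iff\<close>)
qed

lemma T_left_cancellative:
  "Hausdorff_space (topol G) \<Longrightarrow> left_cancellative (T_monoid G)"
  unfolding left_cancellative_def using S_mult_left_cancel by (simp add: T_set_iff)

lemma conj_inv_conj_inv:
  assumes "f \<in> extensional (arrows G)" "\<And>x. x \<in> arrows G \<Longrightarrow> f x \<in> arrows G"
  shows "conj_inv G (conj_inv G f) = f"
  by (rule extensionalityI[of _ "arrows G"])
    (use assms in \<open>auto simp: conj_inv_def inv_closed inv_inv\<close>)

lemma continuous_conj_inv:
  assumes "continuous_map (topol G) (topol G) f"
  shows "continuous_map (topol G) (topol G) (conj_inv G f)"
  using continuous_map_compose[OF continuous_map_compose[OF continuous_inv assms] continuous_inv]
  by (simp add: conj_inv_def continuous_map_restrict o_def)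

lemma conj_inv_S:
  "f \<in> carrier (S_monoid G) \<Longrightarrow> conj_inv G f \<in> carrier (S'_monoid G)"
  unfolding S_carrier_iff S'_carrier_iff
  by (auto simp: continuous_conj_inv)
    (auto simp: conj_inv_def inv_closed range_map_inv)

lemma conj_inv_S':
  "h \<in> carrier (S'_monoid G) \<Longrightarrow> conj_inv G h \<in> carrier (S_monoid G)"
  unfolding S_carrier_iff S'_carrier_iff
  by (auto simp: continuous_conj_inv)
    (auto simp: conj_inv_def inv_closed domain_map_inv)

lemma conj_inv_translation:
  assumes f: "f \<in> carrier (S_monoid G)" and x: "x \<in> arrows G"
  shows "gmult G x (conj_inv G f x) = ginv G (gmult G (f (ginv G x)) (ginv G x))"
  using inv_mult[OF S_translation(1)[OF f inv_closed[OF x]]] x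
  by (simp add: conj_inv_def inv_inv)

lemma conj_inv_translation':
  assumes h: "h \<in> carrier (S'_monoid G)" and x: "x \<in> arrows G"
  shows "gmult G (conj_inv G h x) x = ginv G (gmult G (ginv G x) (h (ginv G x)))"
  using inv_mult[OF S'_translation(1)[OF h inv_closed[OF x]]] x
  by (simp add: conj_inv_def inv_inv)

lemma conj_inv_one: "conj_inv G \<one>\<^bsub>S_monoid G\<^esub> = \<one>\<^bsub>S'_monoid G\<^esub>"
  by (rule extensionalityI[of _ "arrows G"])
    (auto simp: conj_inv_def S_monoid_def S'_monoid_def inv_closed inv_domain_map range_map_inv)

lemma conj_inv_mult:
  assumes f: "f \<in> carrier (S_monoid G)" and g: "g \<in> carrier (S_monoid G)"
  shows "conj_inv G (f \<otimes>\<^bsub>S_monoid G\<^esub> g) = conj_inv G f \<otimes>\<^bsub>S'_monoid G\<^esub> conj_inv G g"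
proof (rule extensionalityI[of _ "arrows G"])
  fix x assume x: "x \<in> arrows G"
  define y where "y = gmult G (f (ginv G x)) (ginv G x)"
  have ix: "ginv G x \<in> arrows G"
    using x by (rule inv_closed)
  have y: "y \<in> arrows G"
    unfolding y_def using S_translation(1)[OF f ix] by (rule mult_closed)
  have "conj_inv G (f \<otimes>\<^bsub>S_monoid G\<^esub> g) x = ginv G (gmult G (g y) (f (ginv G x)))"
    by (simp add: conj_inv_def x S_mult_apply ix y_def)
  also have "\<dots> = gmult G (ginv G (f (ginv G x))) (ginv G (g y))"
    using S_mult_composable[OF f g ix] by (simp add: inv_mult y_def)
  also have "\<dots> = gmult G (conj_inv G f x) (conj_inv G g (ginv G y))"
    by (simp add: conj_inv_def x inv_closed inv_inv y)
  also have "ginv G y = gmult G x (conj_inv G f x)"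
    by (simp add: conj_inv_translation[OF f x] y_def)
  finally show "conj_inv G (f \<otimes>\<^bsub>S_monoid G\<^esub> g) x =
      (conj_inv G f \<otimes>\<^bsub>S'_monoid G\<^esub> conj_inv G g) x"
    by (simp add: S'_mult_apply x)
qed (simp_all add: conj_inv_def S'_monoid_def)

text \<open>Conjugation permutes the argument by inversion, a bijection of the arrows, so the range of the
  conjugated translation is exactly the inverse of the original range.\<close>

lemma conj_inv_T:
  assumes "f \<in> T_set G"
  shows "conj_inv G f \<in> T'_set G"
proof -
  have f: "f \<in> carrier (S_monoid G)"
    using assms by (simp add: T_set_iff)
  have "(\<lambda>x. gmult G x (conj_inv G f x)) ` arrows G =
      (\<lambda>x. ginv G (gmult G (f x) x)) ` ginv G ` arrows G"
    by (simp add: image_image conj_inv_translation[OF f] cong: image_cong)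
  also have "\<dots> = ginv G ` (\<lambda>x. gmult G (f x) x) ` arrows G"
    by (simp add: inv_image_arrows image_image)
  finally show ?thesis
    using assms by (simp add: T'_set_iff T_set_iff conj_inv_S dense_set_inv_image)
qed

lemma conj_inv_T':
  assumes "h \<in> T'_set G"
  shows "conj_inv G h \<in> T_set G"
proof -
  have h: "h \<in> carrier (S'_monoid G)"
    using assms by (simp add: T'_set_iff)
  have "(\<lambda>x. gmult G (conj_inv G h x) x) ` arrows G =
      (\<lambda>x. ginv G (gmult G x (h x))) ` ginv G ` arrows G"
    by (simp add: image_image conj_inv_translation'[OF h] cong: image_cong)
  also have "\<dots> = ginv G ` (\<lambda>x. gmult G x (h x)) ` arrows G"
    by (simp add: inv_image_arrows image_image)
  finally show ?thesis
    using assms by (simp add: T'_set_iff T_set_iff conj_inv_S' dense_set_inv_image)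
qed

lemma conj_inv_bij: "bij_betw (conj_inv G) (T_set G) (T'_set G)"
  by (rule bij_betw_byWitness[where f' = "conj_inv G"])
    (auto simp: conj_inv_T conj_inv_T',
     auto simp: T_set_iff T'_set_iff S_carrier_iff S'_carrier_iff conj_inv_conj_inv)

lemma conj_inv_iso: "conj_inv G \<in> iso (T_monoid G) (T'_monoid G)"
  using conj_inv_bij by (auto simp: iso_def hom_def conj_inv_T T_set_iff conj_inv_mult)

lemma T'_submonoid: "submonoid (T'_set G) (S'_monoid G)"
proof
  show "T'_set G \<subseteq> carrier (S'_monoid G)"
    by (auto simp: T'_set_iff)
  show "\<one>\<^bsub>S'_monoid G\<^esub> \<in> T'_set G"
    using conj_inv_T[OF T_one_closed] by (simp add: conj_inv_one)
  fix h k assume "h \<in> T'_set G" "k \<in> T'_set G"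
  then obtain f g where fg: "f \<in> T_set G" "g \<in> T_set G"
    and "h = conj_inv G f" "k = conj_inv G g"
    using bij_betw_imp_surj_on[OF conj_inv_bij] by blast
  then show "h \<otimes>\<^bsub>S'_monoid G\<^esub> k \<in> T'_set G"
    using conj_inv_T[OF T_mult_closed[OF fg]] by (simp add: T_set_iff conj_inv_mult)
qed

lemma T'_left_cancellative:
  assumes "Hausdorff_space (topol G)"
  shows "left_cancellative (T'_monoid G)"
  by (rule left_cancellative_iso[OF conj_inv_iso T_left_cancellative[OF assms]])
    (simp add: T_mult_closed)

end

theorem proposition3p12:
  fixes G :: "'a top_groupoid"
  assumes "topological_groupoid G"
    and "locally_compact_space (topol G)"
    and "Hausdorff_space (topol G)"
  shows "(submonoid (T_set G) (S_monoid G) \<and> left_cancellative (T_monoid G)) \<and>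
    (submonoid (T'_set G) (S'_monoid G) \<and> left_cancellative (T'_monoid G)) \<and>
    T_monoid G \<cong> T'_monoid G"
proof -
  interpret topological_groupoid G by fact
  show ?thesis
    using assms(3) T_submonoid T'_submonoid T_left_cancellative T'_left_cancellative conj_inv_iso
    by (auto simp: is_iso_def)
qed

end
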